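(* Let $k\ge 1$ be an integer. The generating function $\sum_{n\ge 0}a_k(n)x^n$, where $a_k(n)$ is the number of $k$-balanced binary strings of length $n$, equivalently the number of $u$-$d$ lattice paths with $n$ steps and vertical extent $\le k$, is given by $$ \begin{cases} \dfrac{\mathsf{U}_{m}(x)}{\mathsf{T}_{m+1}(x)}\cdot\dfrac{\mathsf{U}_{m}(x)+x\,\mathsf{U}_{m-1}(x)}{\mathsf{U}_{m}(x)-x\,\mathsf{U}_{m-1}(x)} & \text{if } k=2m \text{ is even},\\[4mm] \dfrac{\mathsf{U}_{m+1}(x)+x\,\mathsf{U}_{m}(x)}{\mathsf{U}_{m+1}(x)-x\,\mathsf{U}_{m}(x)}\cdot\dfrac{\mathsf{U}_{m}(x)}{\mathsf{T}_{m+1}(x)} & \text{if } k=2m+1 \text{ is odd}. \end{cases} $$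
   Context: Generating functions are formal power series in $x$ (rational functions are expanded at $x=0$). For a finite binary string $T$, $\Delta(T)$ denotes the number of $1$'s in $T$ minus the number of $0$'s in $T$. A finite binary string $S$ (possibly empty) is $k$-balanced if every substring $T$ of consecutive bits of $S$ satisfies $-k\le \Delta(T)\le k$. A $u$-$d$ path is a lattice path starting at the origin (possibly empty) consisting of upsteps $u=(1,1)$ and downsteps $d=(1,-1)$; its vertical extent is the maximum height ($y$-coordinate) of its vertices minus the minimum height of its vertices. Binary strings correspond to $u$-$d$ paths by coding one symbol as $u$ and the other as $d$. The combinatorial Chebychev polynomials are $\mathsf{T}_k(x)=2x^kT_k\!\left(\tfrac{1}{2x}\right)$ and $\mathsf{U}_k(x)=x^kU_k\!\left(\tfrac{1}{2x}\right)$, where $T_k,U_k$ are the usual Chebychev polynomials of the first and second kinds. Equivalently, both satisfy the recurrence $\mathsf{P}_k(x)=\mathsf{P}_{k-1}(x)-x^2\mathsf{P}_{k-2}(x)$ for $k\ge 2$, with initial conditions $\mathsf{T}_0=2$, $\mathsf{T}_1=1$ and $\mathsf{U}_0=\mathsf{U}_1=1$. *)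

theory Defs
  imports
    Complex_Main
    "HOL-Library.Sublist"
    "HOL-Library.Product_Plus"
    "HOL-Computational_Algebra.Computational_Algebra"
begin

section \<open>Balanced binary strings\<close>

text \<open>A binary string is a \<^typ>\<open>bool list\<close>, with \<^const>\<open>True\<close> for the bit 1.\<close>

definition Delta :: "bool list \<Rightarrow> int" where
  "Delta T = int (count_list T True) - int (count_list T False)"

text \<open>\<^const>\<open>sublist\<close> is the relation of being a contiguous (possibly empty) substring.\<close>

definition balanced :: "nat \<Rightarrow> bool list \<Rightarrow> bool" where
  "balanced k S \<longleftrightarrow> (\<forall>T. sublist T S \<longrightarrow> - int k \<le> Delta T \<and> Delta T \<le> int k)"

definition num_balanced :: "nat \<Rightarrow> nat \<Rightarrow> nat" where
  "num_balanced k n = card {S. length S = n \<and> balanced k S}"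


section \<open>Lattice paths\<close>

text \<open>
  A path from the origin is given by its list of steps; its vertices are the partial sums of
  the steps.  Addition and zero on \<^typ>\<open>int \<times> int\<close> are componentwise.
\<close>

definition upstep :: "int \<times> int" where
  "upstep = (1, 1)"

definition downstep :: "int \<times> int" where
  "downstep = (1, -1)"

definition ud_path :: "(int \<times> int) list \<Rightarrow> bool" where
  "ud_path P \<longleftrightarrow> set P \<subseteq> {upstep, downstep}"

definition vertices :: "(int \<times> int) list \<Rightarrow> (int \<times> int) set" where
  "vertices P = {sum_list (take i P) | i. i \<le> length P}"

definition vertical_extent :: "(int \<times> int) list \<Rightarrow> int" where
  "vertical_extent P = Max (snd ` vertices P) - Min (snd ` vertices P)"

text \<open>The maximum and minimum are taken over finite nonempty sets.\<close>

lemma finite_vertices: "finite (vertices P)"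
  by (simp add: vertices_def)

lemma origin_in_vertices: "(0, 0) \<in> vertices P"
  by (auto simp: vertices_def zero_prod_def intro!: exI[of _ 0])

definition num_ud_paths :: "nat \<Rightarrow> nat \<Rightarrow> nat" where
  "num_ud_paths k n =
     card {P. ud_path P \<and> length P = n \<and> vertical_extent P \<le> int k}"


section \<open>Chebychev polynomials\<close>

fun cheb_T :: "nat \<Rightarrow> real poly" where
  "cheb_T 0 = 1"
| "cheb_T (Suc 0) = [:0, 1:]"
| "cheb_T (Suc (Suc n)) = [:0, 2:] * cheb_T (Suc n) - cheb_T n"

fun cheb_U :: "nat \<Rightarrow> real poly" where
  "cheb_U 0 = 1"
| "cheb_U (Suc 0) = [:0, 2:]"
| "cheb_U (Suc (Suc n)) = [:0, 2:] * cheb_U (Suc n) - cheb_U n"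

lemma cheb_T_cos: "poly (cheb_T n) (cos t) = cos (real n * t)"
proof (induction n rule: cheb_T.induct)
  case (3 n)
  have "cos (real (Suc n) * t + t) + cos (real (Suc n) * t - t) = 2 * cos t * cos (real (Suc n) * t)"
    by (simp only: cos_add cos_diff) (simp add: algebra_simps)
  moreover have "real (Suc (Suc n)) * t = real (Suc n) * t + t" "real n * t = real (Suc n) * t - t"
    by (simp_all add: algebra_simps)
  ultimately show ?case using 3 by (simp del: of_nat_Suc)
qed auto

lemma cheb_U_sin: "sin t * poly (cheb_U n) (cos t) = sin (real (Suc n) * t)"
proof (induction n rule: cheb_U.induct)
  case (3 n)
  let ?a = "real (Suc (Suc n)) * t"
  have "sin (?a + t) + sin (?a - t) = 2 * cos t * sin ?a"
    by (simp only: sin_add sin_diff) (simp add: algebra_simps)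
  moreover have "real (Suc (Suc (Suc n))) * t = ?a + t" "real (Suc n) * t = ?a - t"
    by (simp_all add: algebra_simps)
  moreover have "sin t * poly (cheb_U (Suc (Suc n))) (cos t) =
      2 * cos t * (sin t * poly (cheb_U (Suc n)) (cos t)) - sin t * poly (cheb_U n) (cos t)"
    by (simp add: algebra_simps)
  ultimately show ?case using 3 by (simp del: of_nat_Suc cheb_U.simps)
qed (auto simp: sin_double)

lemma degree_cheb_T_le: "degree (cheb_T n) \<le> n"
proof (induction n rule: cheb_T.induct)
  case (3 n)
  have "degree ([:0, 2:] * cheb_T (Suc n)) \<le> Suc (Suc n)"
    using 3(1) degree_mult_le[of "[:0, 2:]" "cheb_T (Suc n)"] by simp
  then show ?case using 3(2) by (simp only: cheb_T.simps) (intro degree_diff_le, auto)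
qed auto

lemma degree_cheb_U_le: "degree (cheb_U n) \<le> n"
proof (induction n rule: cheb_U.induct)
  case (3 n)
  have "degree ([:0, 2:] * cheb_U (Suc n)) \<le> Suc (Suc n)"
    using 3(1) degree_mult_le[of "[:0, 2:]" "cheb_U (Suc n)"] by simp
  then show ?case using 3(2) by (simp only: cheb_U.simps) (intro degree_diff_le, auto)
qed auto


section \<open>Combinatorial Chebychev polynomials\<close>

text \<open>
  For a polynomial $p$ of degree at most $k$, the expression $x^k p(1/(2x))$ is a polynomial
  in $x$.
\<close>

definition half_reciprocal :: "nat \<Rightarrow> real poly \<Rightarrow> real poly" where
  "half_reciprocal k p = (\<Sum>i\<le>k. monom (coeff p i / 2 ^ i) (k - i))"

lemma poly_half_reciprocal:
  assumes "degree p \<le> k" "x \<noteq> 0"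
  shows "poly (half_reciprocal k p) x = x ^ k * poly p (1 / (2 * x))"
proof -
  have "poly p (1 / (2 * x)) = (\<Sum>i\<le>k. coeff p i * (1 / (2 * x)) ^ i)"
    unfolding poly_altdef using assms(1)
    by (intro sum.mono_neutral_left) (auto simp: coeff_eq_0)
  then show ?thesis
    using assms(2)
    by (auto simp: half_reciprocal_def poly_sum poly_monom sum_distrib_left power_diff
        power_divide power_mult_distrib field_simps intro!: sum.cong)
qed

definition comb_T :: "nat \<Rightarrow> real poly" where
  "comb_T k = smult 2 (half_reciprocal k (cheb_T k))"

definition comb_U :: "nat \<Rightarrow> real poly" where
  "comb_U k = half_reciprocal k (cheb_U k)"

lemma poly_comb_T: "x \<noteq> 0 \<Longrightarrow> poly (comb_T k) x = 2 * x ^ k * poly (cheb_T k) (1 / (2 * x))"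
  by (simp add: comb_T_def poly_half_reciprocal degree_cheb_T_le)

lemma poly_comb_U: "x \<noteq> 0 \<Longrightarrow> poly (comb_U k) x = x ^ k * poly (cheb_U k) (1 / (2 * x))"
  by (simp add: comb_U_def poly_half_reciprocal degree_cheb_U_le)

lemma poly_eqI_nonzero:
  fixes p q :: "real poly"
  assumes "\<And>x. x \<noteq> 0 \<Longrightarrow> poly p x = poly q x"
  shows "p = q"
proof -
  have "poly ([:0, 1:] * p) = poly ([:0, 1:] * q)"
    using assms by (auto simp: fun_eq_iff)
  then show ?thesis by (simp only: poly_eq_poly_eq_iff) simp
qed

lemma comb_T_0: "comb_T 0 = 2"
  by (rule poly_eqI_nonzero) (simp add: poly_comb_T)

lemma comb_T_1: "comb_T 1 = 1"
  by (rule poly_eqI_nonzero) (simp add: poly_comb_T)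

lemma comb_T_rec: "comb_T (Suc (Suc k)) = comb_T (Suc k) - [:0, 1:]\<^sup>2 * comb_T k"
  by (rule poly_eqI_nonzero) (simp add: poly_comb_T field_simps power2_eq_square)

lemma comb_U_0: "comb_U 0 = 1"
  by (rule poly_eqI_nonzero) (simp add: poly_comb_U)

lemma comb_U_1: "comb_U 1 = 1"
  by (rule poly_eqI_nonzero) (simp add: poly_comb_U)

lemma comb_U_rec: "comb_U (Suc (Suc k)) = comb_U (Suc k) - [:0, 1:]\<^sup>2 * comb_U k"
  by (rule poly_eqI_nonzero) (simp add: poly_comb_U field_simps power2_eq_square)

text \<open>
  Constant terms are 1, so these polynomials are invertible as formal power series, where the
  quotient is the expansion at $x = 0$.  For \<^term>\<open>comb_T\<close> this excludes the index 0.
\<close>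

lemma coeff_comb_T_0: "coeff (comb_T (Suc m)) 0 = 1"
proof (induction m)
  case 0
  then show ?case using comb_T_1 by simp
next
  case (Suc m)
  then show ?case by (simp add: comb_T_rec power2_eq_square coeff_mult_0)
qed

lemma coeff_comb_U_0: "coeff (comb_U m) 0 = 1"
proof (induction m rule: cheb_U.induct)
  case 1
  then show ?case by (simp add: comb_U_0)
next
  case 2
  then show ?case using comb_U_1 by simp
next
  case (3 m)
  then show ?case by (simp add: comb_U_rec power2_eq_square coeff_mult_0)
qed

definition ser_T :: "nat \<Rightarrow> real fps" where
  "ser_T k = fps_of_poly (comb_T k)"

definition ser_U :: "nat \<Rightarrow> real fps" where
  "ser_U k = fps_of_poly (comb_U k)"

lemma ser_T_nth_0: "fps_nth (ser_T (Suc m)) 0 = 1"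
  by (simp add: ser_T_def coeff_comb_T_0)

lemma ser_U_diff_nth_0: "fps_nth (ser_U i - fps_X * ser_U j) 0 = 1"
  by (simp add: ser_U_def coeff_comb_U_0)

end

theory Submission
  imports Defs
begin

text \<open>
  A path of extent $e$ can be placed in the strip of heights $0, \dots, k$ in exactly
  $\max(0, k + 1 - e)$ ways.  Hence $a_k(n) = W_{k+1}(n) - W_k(n)$, where $W_j(n)$ counts the
  walks with $n$ steps, from any start, inside a strip of $j$ heights.  The generating
  functions of walks with fixed start satisfy a linear recurrence in the start, solved by
  Chebychev polynomials.  Cassini's identity and the index-doubling formulas then turn the
  difference into the stated quotients.
\<close>

section \<open>Heights of a binary string\<close>

definition heights :: "bool list \<Rightarrow> int set" where
  "heights S = (\<lambda>i. Delta (take i S)) ` {..length S}"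

lemma finite_heights [simp]: "finite (heights S)"
  by (simp add: heights_def)

lemma zero_in_heights: "0 \<in> heights S"
  by (auto simp: heights_def Delta_def intro!: image_eqI[of _ _ 0])

lemma heights_nonempty [simp]: "heights S \<noteq> {}"
  using zero_in_heights by blast

lemma Delta_append: "Delta (S @ T) = Delta S + Delta T"
  by (simp add: Delta_def)

lemma Delta_Cons: "Delta (b # S) = (if b then 1 else -1) + Delta S"
  by (simp add: Delta_def)

lemma heights_Cons: "heights (b # S) = insert 0 ((+) (if b then 1 else -1) ` heights S)"
proof -
  have "heights (b # S) = (\<lambda>i. Delta (take i (b # S))) ` insert 0 (Suc ` {..length S})"
    by (simp only: heights_def length_Cons atMost_Suc_eq_insert_0)
  also have "\<dots> = insert 0 ((+) (if b then 1 else -1) ` heights S)"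
    by (simp add: heights_def image_image Delta_Cons) (simp add: Delta_def)
  finally show ?thesis .
qed

text \<open>By additivity, \<open>Delta\<close> of a substring is the difference of the heights at
  its two ends, so balance bounds every difference of heights, in particular the largest.\<close>

lemma balanced_iff_heights: "balanced k S \<longleftrightarrow> Max (heights S) - Min (heights S) \<le> int k"
proof
  assume bal: "balanced k S"
  have le: "Delta (take j S) - Delta (take i S) \<le> int k" for i j
  proof (cases "i \<le> j")
    case True
    then have "take j S = take i S @ drop i (take j S)"
      by (metis append_take_drop_id min.absorb1 take_take)
    moreover have "sublist (drop i (take j S)) S"
      by (meson sublist_drop sublist_order.dual_order.trans sublist_take)
    ultimately show ?thesis
      using bal unfolding balanced_def by (metis Delta_append add_diff_cancel_left')
  next
    case False
    then have "take i S = take j S @ drop j (take i S)"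
      by (metis append_take_drop_id min.absorb1 nat_le_linear take_take)
    then have "Delta (take i S) = Delta (take j S) + Delta (drop j (take i S))"
      by (metis Delta_append)
    moreover have "sublist (drop j (take i S)) S"
      by (meson sublist_drop sublist_order.dual_order.trans sublist_take)
    \<comment> \<open>Here \<open>j < i\<close>, so the wanted difference is minus the
      \<open>Delta\<close> of the substring and the lower bound is the one to use.\<close>
    then have "- int k \<le> Delta (drop j (take i S))"
      using bal by (simp add: balanced_def)
    ultimately show ?thesis by linarith
  qed
  have "Max (heights S) \<in> heights S" "Min (heights S) \<in> heights S"
    by simp_all
  then obtain i j where "Max (heights S) = Delta (take j S)" "Min (heights S) = Delta (take i S)"
    unfolding heights_def by blast
  then show "Max (heights S) - Min (heights S) \<le> int k"
    using le by simp
next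
  assume ext: "Max (heights S) - Min (heights S) \<le> int k"
  show "balanced k S"
    unfolding balanced_def
  proof (intro allI impI)
    fix T assume "sublist T S"
    then obtain A B where S: "S = A @ T @ B"
      by (auto simp: sublist_def)
    have "Delta A \<in> heights S"
      unfolding heights_def S by (rule image_eqI[of _ _ "length A"]) auto
    moreover have "Delta A + Delta T \<in> heights S"
      unfolding heights_def S by (rule image_eqI[of _ _ "length (A @ T)"]) (auto simp: Delta_append)
    ultimately have "Min (heights S) \<le> Delta A" "Delta A \<le> Max (heights S)"
        "Min (heights S) \<le> Delta A + Delta T" "Delta A + Delta T \<le> Max (heights S)"
      by simp_all
    then show "- int k \<le> Delta T \<and> Delta T \<le> int k"
      using ext by linarith
  qed
qed

section \<open>Binary strings as lattice paths\<close>

definition step :: "bool \<Rightarrow> int \<times> int" where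
  "step b = (if b then upstep else downstep)"

lemma inj_step: "inj step"
  by (auto simp: inj_def step_def upstep_def downstep_def)

lemma snd_sum_list_steps: "snd (sum_list (map step S)) = Delta S"
  by (induction S) (auto simp: Delta_def step_def upstep_def downstep_def)

lemma vertical_extent_steps:
  "vertical_extent (map step S) = Max (heights S) - Min (heights S)"
proof -
  have "vertices (map step S) = (\<lambda>i. sum_list (map step (take i S))) ` {..length S}"
    by (auto simp: vertices_def take_map)
  then have "snd ` vertices (map step S) = heights S"
    by (simp add: heights_def image_image snd_sum_list_steps)
  then show ?thesis by (simp add: vertical_extent_def)
qed

lemma range_map_step: "range (map step) = {P. ud_path P}"
proof -
  have "range step = {upstep, downstep}"
    by (auto simp: step_def image_iff)
  then show ?thesis
    using lists_image[of step UNIV] by (simp add: ud_path_def lists_eq_set)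
qed

lemma num_balanced_eq_num_ud_paths: "num_balanced k n = num_ud_paths k n"
proof -
  have "{P. ud_path P \<and> length P = n \<and> vertical_extent P \<le> int k} =
      map step ` {S. length S = n \<and> balanced k S}"
  proof (intro equalityI subsetI)
    fix P assume P: "P \<in> {P. ud_path P \<and> length P = n \<and> vertical_extent P \<le> int k}"
    then obtain S where "P = map step S"
      using range_map_step by blast
    then show "P \<in> map step ` {S. length S = n \<and> balanced k S}"
      using P by (auto simp: vertical_extent_steps balanced_iff_heights)
  next
    fix P assume "P \<in> map step ` {S. length S = n \<and> balanced k S}"
    then show "P \<in> {P. ud_path P \<and> length P = n \<and> vertical_extent P \<le> int k}"
      using range_map_step by (auto simp: vertical_extent_steps balanced_iff_heights)
  qed
  moreover have "inj_on (map step) A" for A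
    using inj_on_subset[OF inj_mapI[OF inj_step]] by blast
  ultimately show ?thesis
    by (simp add: num_balanced_def num_ud_paths_def card_image)
qed


section \<open>Walks in a strip\<close>

text \<open>The heights 0 and \<open>L\<close> are forbidden walls, with \<open>L - 1\<close>
  heights between them. Walls are still allowed as values of \<open>c\<close>: the counts vanish
  there, which gives the boundary values for the recurrence in \<open>c\<close>.\<close>

definition in_strip :: "nat \<Rightarrow> nat \<Rightarrow> bool list \<Rightarrow> bool" where
  "in_strip L c S \<longleftrightarrow> (\<forall>h\<in>heights S. 0 < int c + h \<and> int c + h < int L)"

definition num_walks :: "nat \<Rightarrow> nat \<Rightarrow> nat \<Rightarrow> nat" where
  "num_walks L c n = card {S. length S = n \<and> in_strip L c S}"

lemma finite_bool_lists: "finite {S :: bool list. length S = n \<and> P S}"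
  by (rule finite_subset[OF _ finite_lists_length_eq[of UNIV n]]) auto

lemma in_strip_bounds: "in_strip L c S \<Longrightarrow> 0 < c \<and> c < L"
  using zero_in_heights[of S] by (force simp: in_strip_def)

lemma in_strip_Nil: "in_strip L c [] \<longleftrightarrow> 0 < c \<and> c < L"
  by (simp add: in_strip_def heights_def Delta_def)

lemma in_strip_Cons:
  "in_strip L c (b # S) \<longleftrightarrow> 0 < c \<and> c < L \<and> in_strip L (if b then c + 1 else c - 1) S"
proof (cases "0 < c")
  case True
  \<comment> \<open>For \<open>c > 0\<close> the natural number \<open>c - 1\<close> is the true
    predecessor; for \<open>c = 0\<close> both sides of the lemma are false.\<close>
  then have "int (if b then c + 1 else c - 1) = int c + (if b then 1 else -1)"
    by auto
  then show ?thesis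
    using True by (simp add: in_strip_def heights_Cons add.assoc)
qed (simp add: in_strip_def heights_Cons)

lemma num_walks_outside: "\<not> (0 < c \<and> c < L) \<Longrightarrow> num_walks L c n = 0"
proof -
  assume "\<not> (0 < c \<and> c < L)"
  then have "{S. length S = n \<and> in_strip L c S} = {}"
    using in_strip_bounds by blast
  then show ?thesis by (simp only: num_walks_def card.empty)
qed

lemma num_walks_0: "0 < c \<Longrightarrow> c < L \<Longrightarrow> num_walks L c 0 = 1"
proof -
  assume "0 < c" "c < L"
  then have "{S. length S = 0 \<and> in_strip L c S} = {[]}"
    by (auto simp: in_strip_Nil)
  then show ?thesis by (simp add: num_walks_def)
qed

text \<open>The walks split by their first step. A neighbour of \<open>c\<close> may be a wall,
  where the count is 0.\<close>

lemma num_walks_Suc: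
  assumes "0 < c" "c < L"
  shows "num_walks L c (Suc n) = num_walks L (c + 1) n + num_walks L (c - 1) n"
proof -
  let ?A = "\<lambda>c. {S. length S = n \<and> in_strip L c S}"
  have eq: "{S. length S = Suc n \<and> in_strip L c S} =
      (#) True ` ?A (c + 1) \<union> (#) False ` ?A (c - 1)"
  proof (rule set_eqI)
    fix S
    show "S \<in> {S. length S = Suc n \<and> in_strip L c S} \<longleftrightarrow>
        S \<in> (#) True ` ?A (c + 1) \<union> (#) False ` ?A (c - 1)"
    proof (cases S)
      case (Cons b T)
      then show ?thesis
        using assms by (cases b) (simp_all add: in_strip_Cons image_iff)
    qed auto
  qed
  show ?thesis
    unfolding num_walks_def eq
    by (subst card_Un_disjoint) (auto simp: finite_bool_lists card_image)
qed

section \<open>Counting the placements of a string in a strip\<close>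

text \<open>The admissible starts form the interval from \<open>1 - a\<close> to
  \<open>L - b - 1\<close>; the maximum with 0 covers the case where it is empty.\<close>

lemma card_shifts:
  assumes "a \<le> 0" "0 \<le> b"
  shows "int (card {c. c \<le> L \<and> 0 < int c + a \<and> int c + b < int L}) = max 0 (int L - 1 - (b - a))"
proof -
  have "{c. c \<le> L \<and> 0 < int c + a \<and> int c + b < int L} = {nat (1 - a)..<nat (int L - b)}"
    using assms by (auto simp: nat_le_iff zless_nat_eq_int_zless)
  then show ?thesis
    using assms by simp
qed

text \<open>A walk stays in the strip iff its lowest and highest points do, so
  \<open>card_shifts\<close> applies to the two extreme heights.\<close>

lemma card_in_strip:
  "int (card {c. c \<le> L \<and> in_strip L c S}) = max 0 (int L - 1 - (Max (heights S) - Min (heights S)))"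
proof -
  have bds: "Min (heights S) \<le> 0" "0 \<le> Max (heights S)"
    using zero_in_heights by simp_all
  have "in_strip L c S \<longleftrightarrow> 0 < int c + Min (heights S) \<and> int c + Max (heights S) < int L" for c
  proof
    assume "in_strip L c S"
    then show "0 < int c + Min (heights S) \<and> int c + Max (heights S) < int L"
      by (simp add: in_strip_def)
  next
    assume a: "0 < int c + Min (heights S) \<and> int c + Max (heights S) < int L"
    show "in_strip L c S"
      unfolding in_strip_def
    proof
      fix h assume "h \<in> heights S"
      then have "Min (heights S) \<le> h" "h \<le> Max (heights S)"
        by simp_all
      then show "0 < int c + h \<and> int c + h < int L"
        using a by linarith
    qed
  qed
  then show ?thesis
    using card_shifts[OF bds] by (simp only:)
qed

text \<open>Double counting of the pairs of a start \<open>c\<close> and a string \<open>S\<close>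
  that stays in the strip from \<open>c\<close>.\<close>

lemma sum_num_walks:
  "(\<Sum>c\<le>L. num_walks L c n) = (\<Sum>S | length S = n. card {c. c \<le> L \<and> in_strip L c S})"
proof -
  have "(\<Sum>c\<le>L. \<Sum>S | S \<in> {S. length S = n} \<and> in_strip L c S. 1 :: nat) =
      (\<Sum>S | length S = n. \<Sum>c | c \<in> {..L} \<and> in_strip L c S. 1)"
    using finite_bool_lists[of n "\<lambda>_. True"] by (intro sum.swap_restrict) auto
  then show ?thesis by (simp add: num_walks_def)
qed

text \<open>A string of extent \<open>e\<close> has \<open>max 0 (k + 1 - e)\<close> placements for
  \<open>L = k + 2\<close> and \<open>max 0 (k - e)\<close> for \<open>L = k + 1\<close>; these
  differ by 1 if \<open>e \<le> k\<close> and agree otherwise.\<close>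

lemma num_balanced_eq_diff:
  "int (num_balanced k n) =
     (\<Sum>c\<le>k + 2. int (num_walks (k + 2) c n)) - (\<Sum>c\<le>k + 1. int (num_walks (k + 1) c n))"
proof -
  have "(\<Sum>c\<le>k + 2. int (num_walks (k + 2) c n)) - (\<Sum>c\<le>k + 1. int (num_walks (k + 1) c n)) =
      (\<Sum>S | length S = n. int (card {c. c \<le> k + 2 \<and> in_strip (k + 2) c S}) -
         int (card {c. c \<le> k + 1 \<and> in_strip (k + 1) c S}))"
    by (simp only: of_nat_sum[symmetric] sum_num_walks) (simp only: of_nat_sum sum_subtractf)
  also have "\<dots> = (\<Sum>S | length S = n. if balanced k S then 1 else 0)"
  proof (intro sum.cong refl)
    fix S :: "bool list"
    obtain e where "e = Max (heights S) - Min (heights S)"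
      by blast
    then show "int (card {c. c \<le> k + 2 \<and> in_strip (k + 2) c S}) -
        int (card {c. c \<le> k + 1 \<and> in_strip (k + 1) c S}) = (if balanced k S then 1 else 0)"
      unfolding card_in_strip balanced_iff_heights by (simp flip: \<open>e = _\<close>)
  qed
  also have "\<dots> = int (num_balanced k n)"
    using finite_bool_lists[of n "\<lambda>_. True"]
    by (simp add: num_balanced_def sum.inter_filter[symmetric])
  finally show ?thesis by simp
qed


section \<open>Chebychev series\<close>

text \<open>The index is shifted so that the series vanishes at 0, i.e. $U_{-1} = 0$.\<close>

definition cheb_ser :: "nat \<Rightarrow> real fps" where
  "cheb_ser n = (case n of 0 \<Rightarrow> 0 | Suc j \<Rightarrow> ser_U j)"

lemma cheb_ser_0 [simp]: "cheb_ser 0 = 0"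
  and cheb_ser_Suc: "cheb_ser (Suc n) = ser_U n"
  by (simp_all add: cheb_ser_def)

lemma fps_of_poly_linear: "fps_of_poly [:0, 1:] = (fps_X :: real fps)"
  by (simp add: fps_of_poly_pCons)

lemma cheb_ser_1 [simp]: "cheb_ser (Suc 0) = 1"
  by (simp add: cheb_ser_Suc ser_U_def comb_U_0)

lemma cheb_ser_rec: "cheb_ser (Suc (Suc n)) = cheb_ser (Suc n) - fps_X\<^sup>2 * cheb_ser n"
proof (cases n)
  case 0
  then show ?thesis
    using comb_U_1 by (simp add: cheb_ser_Suc ser_U_def comb_U_0)
next
  case (Suc j)
  then show ?thesis
    by (simp add: cheb_ser_Suc ser_U_def comb_U_rec fps_of_poly_diff fps_of_poly_mult
        fps_of_poly_power fps_of_poly_linear)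
qed

lemma cheb_ser_Suc_nonzero: "cheb_ser (Suc n) \<noteq> 0"
proof
  assume "cheb_ser (Suc n) = 0"
  then have "fps_nth (ser_U n) 0 = 0"
    by (simp add: cheb_ser_Suc)
  then show False
    by (simp add: ser_U_def coeff_comb_U_0)
qed

text \<open>The counterpart of 2 T_n = U_n - U_(n-2). Both sides obey the same recurrence and agree
  at the first two indices.\<close>

lemma ser_T_eq: "ser_T (Suc m) = cheb_ser (Suc (Suc m)) - fps_X\<^sup>2 * cheb_ser m"
proof (induction m rule: cheb_T.induct)
  case 1
  then show ?case
    using comb_T_1 by (simp add: ser_T_def cheb_ser_rec)
next
  case 2
  then show ?case
    using comb_T_1 by (simp add: ser_T_def comb_T_rec comb_T_0 cheb_ser_rec fps_of_poly_diff
        fps_of_poly_mult fps_of_poly_power fps_of_poly_linear fps_of_poly_numeral)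
next
  case (3 m)
  have "ser_T (Suc (Suc (Suc m))) = ser_T (Suc (Suc m)) - fps_X\<^sup>2 * ser_T (Suc m)"
    by (simp add: ser_T_def comb_T_rec fps_of_poly_diff fps_of_poly_mult fps_of_poly_power
        fps_of_poly_linear)
  also have "\<dots> = cheb_ser (Suc (Suc (Suc (Suc m)))) - fps_X\<^sup>2 * cheb_ser (Suc (Suc m))"
    unfolding 3 by (simp add: cheb_ser_rec algebra_simps)
  finally show ?case .
qed

text \<open>By the recurrence, advancing \<open>n\<close> multiplies the quadratic form by
  \<open>fps_X\<^sup>2\<close>; at \<open>n = 0\<close> it is 1.\<close>

lemma cheb_ser_cassini:
  "(cheb_ser (Suc n))\<^sup>2 - cheb_ser (Suc n) * cheb_ser n + fps_X\<^sup>2 * (cheb_ser n)\<^sup>2 = fps_X ^ (2 * n)"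
proof (induction n)
  case (Suc n)
  have "(cheb_ser (Suc (Suc n)))\<^sup>2 - cheb_ser (Suc (Suc n)) * cheb_ser (Suc n)
      + fps_X\<^sup>2 * (cheb_ser (Suc n))\<^sup>2 =
      fps_X\<^sup>2 * ((cheb_ser (Suc n))\<^sup>2 - cheb_ser (Suc n) * cheb_ser n + fps_X\<^sup>2 * (cheb_ser n)\<^sup>2)"
    by (simp add: cheb_ser_rec algebra_simps power2_eq_square)
  also have "\<dots> = fps_X ^ (2 * Suc n)"
    by (simp only: Suc.IH) (simp add: power2_eq_square)
  finally show ?case .
qed simp

text \<open>The counterparts of U_(2m) = U_m^2 - U_(m-1)^2 and U_(2m+1) = 2 U_m T_(m+1). They are
  proved together because the recurrence for each uses the other.\<close>

lemma cheb_ser_double: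
  "cheb_ser (2 * m + 1) = (cheb_ser (Suc m))\<^sup>2 - fps_X\<^sup>2 * (cheb_ser m)\<^sup>2"
  "cheb_ser (2 * m + 2) = cheb_ser (Suc m) * ser_T (Suc m)"
proof -
  have "cheb_ser (2 * m + 1) = (cheb_ser (Suc m))\<^sup>2 - fps_X\<^sup>2 * (cheb_ser m)\<^sup>2 \<and>
    cheb_ser (2 * m + 2) = cheb_ser (Suc m) * ser_T (Suc m)"
  proof (induction m)
    case 0
    then show ?case by (simp add: ser_T_eq cheb_ser_rec numeral_2_eq_2)
  next
    case (Suc m)
    have odd: "cheb_ser (2 * Suc m + 1) = cheb_ser (2 * m + 2) - fps_X\<^sup>2 * cheb_ser (2 * m + 1)"
      using cheb_ser_rec[of "2 * m + 1"] by (simp add: eval_nat_numeral)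
    have even: "cheb_ser (2 * Suc m + 2) = cheb_ser (2 * Suc m + 1) - fps_X\<^sup>2 * cheb_ser (2 * m + 2)"
      using cheb_ser_rec[of "2 * m + 2"] by (simp add: eval_nat_numeral)
    show ?case
      unfolding even odd Suc[THEN conjunct1] Suc[THEN conjunct2]
      by (simp add: ser_T_eq cheb_ser_rec algebra_simps power2_eq_square)
  qed
  then show "cheb_ser (2 * m + 1) = (cheb_ser (Suc m))\<^sup>2 - fps_X\<^sup>2 * (cheb_ser m)\<^sup>2"
    "cheb_ser (2 * m + 2) = cheb_ser (Suc m) * ser_T (Suc m)"
    by blast+
qed

text \<open>Raising \<open>L\<close> multiplies the sum by x and adds one term. This evaluates the
  correction terms of the walk series, summed over all starts.\<close>

lemma sum_cheb_ser:
  "(1 - 2 * fps_X) * (\<Sum>i\<le>L. fps_X ^ (L - i) * cheb_ser i) =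
     cheb_ser (Suc L) - fps_X * cheb_ser L - fps_X ^ L"
proof (induction L)
  case (Suc L)
  have "(\<Sum>i\<le>Suc L. fps_X ^ (Suc L - i) * cheb_ser i) =
      fps_X * (\<Sum>i\<le>L. fps_X ^ (L - i) * cheb_ser i) + cheb_ser (Suc L)"
    by (simp add: sum_distrib_left Suc_diff_le mult.assoc)
  then have "(1 - 2 * fps_X) * (\<Sum>i\<le>Suc L. fps_X ^ (Suc L - i) * cheb_ser i) =
      fps_X * ((1 - 2 * fps_X) * (\<Sum>i\<le>L. fps_X ^ (L - i) * cheb_ser i))
      + (1 - 2 * fps_X) * cheb_ser (Suc L)"
    by (simp add: algebra_simps)
  then show ?case
    unfolding Suc.IH by (simp add: cheb_ser_rec algebra_simps power2_eq_square)
qed simp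


section \<open>Generating functions of walks\<close>

definition walk_ser :: "nat \<Rightarrow> nat \<Rightarrow> real fps" where
  "walk_ser L c = Abs_fps (\<lambda>n. real (num_walks L c n))"

lemma walk_ser_outside: "\<not> (0 < c \<and> c < L) \<Longrightarrow> walk_ser L c = 0"
  by (rule fps_ext) (simp add: walk_ser_def num_walks_outside)

lemma walk_ser_rec:
  assumes "0 < c" "c < L"
  shows "walk_ser L c = 1 + fps_X * (walk_ser L (c - 1) + walk_ser L (c + 1))"
proof (rule fps_ext)
  fix n
  show "fps_nth (walk_ser L c) n =
      fps_nth (1 + fps_X * (walk_ser L (c - 1) + walk_ser L (c + 1))) n"
    using assms by (cases n) (simp_all add: walk_ser_def num_walks_0 num_walks_Suc)
qed

text \<open>The factor x makes coefficient \<open>n + 1\<close> of \<open>d i\<close> depend only on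
  coefficient \<open>n\<close> of its neighbours, so all coefficients vanish by induction on
  \<open>n\<close>, simultaneously for all \<open>i\<close>.\<close>

lemma fps_boundary_unique:
  fixes d :: "nat \<Rightarrow> 'a :: comm_ring_1 fps"
  assumes "d 0 = 0" "d L = 0"
    and rec: "\<And>i. 0 < i \<Longrightarrow> i < L \<Longrightarrow> d i = fps_X * (d (i - 1) + d (i + 1))"
    and "i \<le> L"
  shows "d i = 0"
proof (rule fps_ext)
  fix n
  have "\<forall>i\<le>L. fps_nth (d i) n = 0"
  proof (induction n)
    case 0
    have "fps_nth (d i) 0 = 0" if "0 < i" "i < L" for i
      unfolding rec[OF that] by simp
    then show ?case
      using assms(1,2) by (metis fps_zero_nth le_neq_implies_less neq0_conv)
  next
    case (Suc n)
    have "fps_nth (d i) (Suc n) = 0" if "0 < i" "i < L" for i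
      unfolding rec[OF that] using that Suc by simp
    then show ?case
      using assms(1,2) by (metis fps_zero_nth le_neq_implies_less neq0_conv)
  qed
  then show "fps_nth (d i) n = fps_nth 0 n"
    using \<open>i \<le> L\<close> by simp
qed

text \<open>
  The constant series $1/(1-2x)$ solves the recurrence in the start; the two subtracted terms
  solve the homogeneous recurrence and correct the boundary values.
\<close>

lemma walk_ser_closed_form:
  assumes "i \<le> L"
  shows "(1 - 2 * fps_X) * cheb_ser L * walk_ser L i =
    cheb_ser L - fps_X ^ i * cheb_ser (L - i) - fps_X ^ (L - i) * cheb_ser i"
proof -
  define d where "d i = (1 - 2 * fps_X) * cheb_ser L * walk_ser L i -
    (cheb_ser L - fps_X ^ i * cheb_ser (L - i) - fps_X ^ (L - i) * cheb_ser i)" for i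
  have "d i = 0"
  proof (rule fps_boundary_unique[OF _ _ _ assms])
    \<comment> \<open>At a wall one correction term equals \<open>cheb_ser L\<close> and the other
      contains \<open>cheb_ser 0 = 0\<close>.\<close>
    show "d 0 = 0" "d L = 0"
      by (simp_all add: d_def walk_ser_outside)
  next
    fix j assume "0 < j" "j < L"
    \<comment> \<open>Writing \<open>j\<close> and \<open>L\<close> through \<open>a\<close> and
      \<open>b\<close> removes the truncated subtractions, so that \<open>cheb_ser_rec\<close>
      applies at both ends.\<close>
    then obtain a b where j: "j = Suc a" and L: "L = Suc a + Suc b"
      by (metis less_imp_Suc_add add_Suc_right add_Suc gr0_implies_Suc)
    have diffs: "L - j = Suc b" "L - a = Suc (Suc b)" "L - Suc (Suc a) = b" "j - 1 = a"
      "j + 1 = Suc (Suc a)"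
      using j L by simp_all
    have w: "walk_ser L j = 1 + fps_X * (walk_ser L a + walk_ser L (Suc (Suc a)))"
      using walk_ser_rec[OF \<open>0 < j\<close> \<open>j < L\<close>] j by simp
    show "d j = fps_X * (d (j - 1) + d (j + 1))"
      unfolding d_def diffs w unfolding j
      by (simp add: cheb_ser_rec algebra_simps power2_eq_square)
  qed
  then show ?thesis by (simp add: d_def)
qed

text \<open>The two correction sums coincide under the reflection of \<open>i\<close> to
  \<open>L - i\<close>. The second factor \<open>1 - 2 * fps_X\<close> is the one required by
  \<open>sum_cheb_ser\<close>.\<close>

lemma sum_walk_ser:
  "(1 - 2 * fps_X)\<^sup>2 * cheb_ser L * (\<Sum>c\<le>L. walk_ser L c) =
    (1 - 2 * fps_X) * (of_nat (L + 1) * cheb_ser L)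
    - 2 * (cheb_ser (Suc L) - fps_X * cheb_ser L - fps_X ^ L)"
proof -
  have rev: "(\<Sum>i\<le>L. fps_X ^ i * cheb_ser (L - i)) = (\<Sum>i\<le>L. fps_X ^ (L - i) * cheb_ser i)"
    by (rule sum.reindex_bij_witness[of _ "\<lambda>i. L - i" "\<lambda>i. L - i"]) auto
  have "(1 - 2 * fps_X) * cheb_ser L * (\<Sum>c\<le>L. walk_ser L c) =
      (\<Sum>c\<le>L. cheb_ser L - fps_X ^ c * cheb_ser (L - c) - fps_X ^ (L - c) * cheb_ser c)"
    unfolding sum_distrib_left by (intro sum.cong refl walk_ser_closed_form) simp
  also have "\<dots> = of_nat (L + 1) * cheb_ser L - 2 * (\<Sum>i\<le>L. fps_X ^ (L - i) * cheb_ser i)"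
    by (simp add: sum_subtractf rev)
  finally have eq: "(1 - 2 * fps_X) * cheb_ser L * (\<Sum>c\<le>L. walk_ser L c) =
      of_nat (L + 1) * cheb_ser L - 2 * (\<Sum>i\<le>L. fps_X ^ (L - i) * cheb_ser i)" .
  have "(1 - 2 * fps_X)\<^sup>2 * cheb_ser L * (\<Sum>c\<le>L. walk_ser L c) =
      (1 - 2 * fps_X) * ((1 - 2 * fps_X) * cheb_ser L * (\<Sum>c\<le>L. walk_ser L c))"
    by (simp only: power2_eq_square mult.assoc)
  also have "\<dots> = (1 - 2 * fps_X) * (of_nat (L + 1) * cheb_ser L)
      - 2 * ((1 - 2 * fps_X) * (\<Sum>i\<le>L. fps_X ^ (L - i) * cheb_ser i))"
    unfolding eq by (simp only: right_diff_distrib mult.left_commute)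
  finally show ?thesis
    unfolding sum_cheb_ser .
qed


section \<open>Generating function of balanced strings\<close>

definition balanced_ser :: "nat \<Rightarrow> real fps" where
  "balanced_ser k = Abs_fps (\<lambda>n. real (num_balanced k n))"

lemma balanced_ser_eq_diff:
  "balanced_ser k = (\<Sum>c\<le>k + 2. walk_ser (k + 2) c) - (\<Sum>c\<le>k + 1. walk_ser (k + 1) c)"
proof (rule fps_ext)
  fix n
  have "real (num_balanced k n) = real_of_int (int (num_balanced k n))"
    by simp
  also have "\<dots> = (\<Sum>c\<le>k + 2. real (num_walks (k + 2) c n)) - (\<Sum>c\<le>k + 1. real (num_walks (k + 1) c n))"
    by (simp only: num_balanced_eq_diff) simp
  finally show "fps_nth (balanced_ser k) n =
      fps_nth ((\<Sum>c\<le>k + 2. walk_ser (k + 2) c) - (\<Sum>c\<le>k + 1. walk_ser (k + 1) c)) n"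
    by (simp add: balanced_ser_def walk_ser_def fps_sum_nth del: sum.atMost_Suc)
qed

text \<open>Cross-multiplying cancels the terms with \<open>l\<close> up to
  \<open>y * r * s\<close>. The remaining part free of \<open>p\<close> is
  \<open>2 * (s\<^sup>2 - r * t)\<close>, which the recurrence for \<open>t\<close> and Cassini's
  identity turn into \<open>2 * p\<^sup>2\<close>.\<close>

lemma difference_identity:
  fixes y r s t x l p :: "'a :: comm_ring_1"
  assumes V: "y\<^sup>2 * r * V = y * (l * r) - 2 * (s - x * r - p)"
    and W: "y\<^sup>2 * s * W = y * ((l + 1) * s) - 2 * (t - x * s - x * p)"
    and t: "t = s - x\<^sup>2 * r"
    and p: "p\<^sup>2 = s\<^sup>2 - s * r + x\<^sup>2 * r\<^sup>2"
  shows "y\<^sup>2 * (r * s * (W - V)) = y * r * s + 2 * p\<^sup>2 + 2 * p * (x * r - s)"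
proof -
  have "y\<^sup>2 * (r * s * (W - V)) = r * (y\<^sup>2 * s * W) - s * (y\<^sup>2 * r * V)"
    by (simp add: algebra_simps)
  also have "\<dots> = y * r * s + 2 * (s\<^sup>2 - s * r + x\<^sup>2 * r\<^sup>2) + 2 * p * (x * r - s)"
    unfolding V W t by (simp add: algebra_simps power2_eq_square)
  finally show ?thesis
    unfolding p .
qed

lemma balanced_ser_general:
  "(1 - 2 * fps_X)\<^sup>2 * (cheb_ser (k + 1) * cheb_ser (k + 2) * balanced_ser k) =
    (1 - 2 * fps_X) * cheb_ser (k + 1) * cheb_ser (k + 2) + 2 * (fps_X ^ (k + 1))\<^sup>2
    + 2 * fps_X ^ (k + 1) * (fps_X * cheb_ser (k + 1) - cheb_ser (k + 2))"
  unfolding balanced_ser_eq_diff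
\<comment> \<open>Here \<open>r\<close>, \<open>s\<close>, \<open>t\<close> are the series at
  \<open>k + 1\<close>, \<open>k + 2\<close>, \<open>k + 3\<close>, with
  \<open>p = fps_X ^ (k + 1)\<close> and \<open>l = k + 2\<close>.\<close>
proof (rule difference_identity)
  show "(1 - 2 * fps_X)\<^sup>2 * cheb_ser (k + 1) * (\<Sum>c\<le>k + 1. walk_ser (k + 1) c) =
      (1 - 2 * fps_X) * (of_nat (k + 2) * cheb_ser (k + 1))
      - 2 * (cheb_ser (k + 2) - fps_X * cheb_ser (k + 1) - fps_X ^ (k + 1))"
    using sum_walk_ser[of "k + 1"] by (simp only: add_2_eq_Suc' Suc_eq_plus1[symmetric])
  show "(1 - 2 * fps_X)\<^sup>2 * cheb_ser (k + 2) * (\<Sum>c\<le>k + 2. walk_ser (k + 2) c) =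
      (1 - 2 * fps_X) * ((of_nat (k + 2) + 1) * cheb_ser (k + 2))
      - 2 * (cheb_ser (k + 3) - fps_X * cheb_ser (k + 2) - fps_X * fps_X ^ (k + 1))"
    using sum_walk_ser[of "k + 2"]
    by (simp add: numeral_3_eq_3 add.commute del: sum.atMost_Suc)
  show "cheb_ser (k + 3) = cheb_ser (k + 2) - fps_X\<^sup>2 * cheb_ser (k + 1)"
    using cheb_ser_rec[of "k + 1"] by (simp add: numeral_3_eq_3)
  show "(fps_X ^ (k + 1))\<^sup>2 = (cheb_ser (k + 2))\<^sup>2 - cheb_ser (k + 2) * cheb_ser (k + 1)
      + fps_X\<^sup>2 * (cheb_ser (k + 1))\<^sup>2"
    using cheb_ser_cassini[of "k + 1"]
    by (simp only: power_mult[symmetric] mult.commute[of _ 2]) simp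
qed

section \<open>The even and the odd case\<close>

lemma one_minus_2X_nonzero: "(1 - 2 * fps_X :: real fps) \<noteq> 0"
proof
  assume "(1 - 2 * fps_X :: real fps) = 0"
  then have "fps_nth (1 - 2 * fps_X :: real fps) 0 = 0" by simp
  then show False by simp
qed

text \<open>
  In both parities, Cassini's identity makes the power of $x$ a quadratic form in two
  consecutive series $a, b$, so that the general formula becomes a polynomial identity in
  $a$, $b$, $x$.
\<close>

lemma even_identity:
  fixes a b x :: "'a :: comm_ring_1"
  assumes "p = a\<^sup>2 - a * b + x\<^sup>2 * b\<^sup>2" "r = a\<^sup>2 - x\<^sup>2 * b\<^sup>2" "s = a * (a - 2 * x\<^sup>2 * b)"
  shows "(1 - 2 * x) * r * s + 2 * (x * p)\<^sup>2 + 2 * (x * p) * (x * r - s) =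
    (1 - 2 * x)\<^sup>2 * (a * (a + x * b))\<^sup>2"
  unfolding assms by (simp add: algebra_simps power2_eq_square)

lemma odd_identity:
  fixes a b x :: "'a :: comm_ring_1"
  assumes "p = a\<^sup>2 - a * b + x\<^sup>2 * b\<^sup>2" "r = b * (2 * a - b)" "s = a\<^sup>2 - x\<^sup>2 * b\<^sup>2"
  shows "(1 - 2 * x) * r * s + 2 * p\<^sup>2 + 2 * p * (x * r - s) =
    (1 - 2 * x)\<^sup>2 * (b * (a + x * b))\<^sup>2"
  unfolding assms by (simp add: algebra_simps power2_eq_square)

lemma cheb_ser_plus_nonzero: "cheb_ser (Suc n) + fps_X * cheb_ser m \<noteq> 0"
proof
  assume "cheb_ser (Suc n) + fps_X * cheb_ser m = 0"
  then have "fps_nth (ser_U n + fps_X * cheb_ser m) 0 = 0"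
    by (simp add: cheb_ser_Suc)
  then show False
    by (simp add: ser_U_def coeff_comb_U_0)
qed

text \<open>The product of the two denominators is \<open>a * (a + x * b)\<close> times
  \<open>ser_T (Suc m) * (a - x * b)\<close>, where x is \<open>fps_X\<close>. The numerator is the
  square of that first factor, so one copy cancels.\<close>

lemma balanced_ser_even:
  fixes m :: nat
  defines "a \<equiv> cheb_ser (Suc m)" and "b \<equiv> cheb_ser m"
  shows "ser_T (Suc m) * (a - fps_X * b) * balanced_ser (2 * m) = a * (a + fps_X * b)"
proof -
  have T: "ser_T (Suc m) = a - 2 * fps_X\<^sup>2 * b"
    by (simp add: ser_T_eq cheb_ser_rec a_def b_def algebra_simps)
  have r: "cheb_ser (2 * m + 1) = a\<^sup>2 - fps_X\<^sup>2 * b\<^sup>2"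
    and s: "cheb_ser (2 * m + 2) = a * (a - 2 * fps_X\<^sup>2 * b)"
    and p: "fps_X ^ (2 * m) = a\<^sup>2 - a * b + fps_X\<^sup>2 * b\<^sup>2"
    using cheb_ser_double[of m] cheb_ser_cassini[of m] by (simp_all add: a_def b_def T)
  have "(1 - 2 * fps_X)\<^sup>2 * (cheb_ser (2 * m + 1) * cheb_ser (2 * m + 2) * balanced_ser (2 * m)) =
      (1 - 2 * fps_X)\<^sup>2 * (a * (a + fps_X * b))\<^sup>2"
    \<comment> \<open>The general formula contains x to the power \<open>2 * m + 1\<close>, one more
      than Cassini's identity at \<open>m\<close> provides; hence \<open>x * p\<close> in
      \<open>even_identity\<close>.\<close>
    using balanced_ser_general[of "2 * m"] even_identity[OF p r s]
    by (simp only: power_add power_one_right mult.commute[of "fps_X ^ (2 * m)"])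
  then have "cheb_ser (2 * m + 1) * cheb_ser (2 * m + 2) * balanced_ser (2 * m) =
      (a * (a + fps_X * b))\<^sup>2"
    using one_minus_2X_nonzero by simp
  then have "(a * (a + fps_X * b)) * (ser_T (Suc m) * (a - fps_X * b) * balanced_ser (2 * m)) =
      (a * (a + fps_X * b)) * (a * (a + fps_X * b))"
    unfolding r s T by (simp add: algebra_simps power2_eq_square)
  moreover have "a * (a + fps_X * b) \<noteq> 0"
    unfolding a_def b_def
    using cheb_ser_Suc_nonzero cheb_ser_plus_nonzero by simp
  ultimately show ?thesis by (metis mult_left_cancel)
qed

lemma balanced_ser_odd:
  fixes m :: nat
  defines "a \<equiv> cheb_ser (Suc (Suc m))" and "b \<equiv> cheb_ser (Suc m)"
  shows "ser_T (Suc m) * (a - fps_X * b) * balanced_ser (2 * m + 1) = b * (a + fps_X * b)"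
proof -
  \<comment> \<open>The recurrence gives \<open>fps_X\<^sup>2 * cheb_ser m = b - a\<close>, which
    eliminates the third series.\<close>
  have T: "ser_T (Suc m) = 2 * a - b"
    by (simp add: ser_T_eq cheb_ser_rec a_def b_def algebra_simps)
  have r: "cheb_ser (2 * m + 1 + 1) = b * (2 * a - b)"
    and s: "cheb_ser (2 * m + 1 + 2) = a\<^sup>2 - fps_X\<^sup>2 * b\<^sup>2"
    \<comment> \<open>The exponent is \<open>2 * Suc m\<close>, so Cassini's identity at
      \<open>Suc m\<close> fits without an extra factor x.\<close>
    and p: "fps_X ^ (2 * m + 1 + 1) = a\<^sup>2 - a * b + fps_X\<^sup>2 * b\<^sup>2"
    using cheb_ser_double(2)[of m] cheb_ser_double(1)[of "Suc m"] cheb_ser_cassini[of "Suc m"]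
    by (simp_all add: a_def b_def T eval_nat_numeral)
  have "(1 - 2 * fps_X)\<^sup>2 * (cheb_ser (2 * m + 1 + 1) * cheb_ser (2 * m + 1 + 2)
      * balanced_ser (2 * m + 1)) = (1 - 2 * fps_X)\<^sup>2 * (b * (a + fps_X * b))\<^sup>2"
    using balanced_ser_general[of "2 * m + 1"] odd_identity[OF p r s] by (simp only:)
  then have "cheb_ser (2 * m + 1 + 1) * cheb_ser (2 * m + 1 + 2) * balanced_ser (2 * m + 1) =
      (b * (a + fps_X * b))\<^sup>2"
    using one_minus_2X_nonzero by simp
  then have "(b * (a + fps_X * b)) * (ser_T (Suc m) * (a - fps_X * b) * balanced_ser (2 * m + 1)) =
      (b * (a + fps_X * b)) * (b * (a + fps_X * b))"
    unfolding r s T by (simp add: algebra_simps power2_eq_square)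
  moreover have "b * (a + fps_X * b) \<noteq> 0"
    unfolding a_def b_def
    using cheb_ser_Suc_nonzero cheb_ser_plus_nonzero by simp
  ultimately show ?thesis by (metis mult_left_cancel)
qed

section \<open>Passing to quotients of power series\<close>

text \<open>Nonzero constant terms make \<open>c\<close> and \<open>d\<close> units, so division is
  multiplication by the inverse.\<close>

lemma fps_eq_mult_divide:
  fixes A :: "'a :: field fps"
  assumes "c * d * A = p * q" "fps_nth c 0 \<noteq> 0" "fps_nth d 0 \<noteq> 0"
  shows "A = (p / c) * (q / d)"
proof -
  have "(p / c) * (q / d) = (inverse c * c) * (inverse d * d) * A"
    using assms by (simp add: fps_divide_unit) (metis assms(1) mult.assoc mult.commute)
  then show ?thesis
    using assms by (simp add: inverse_mult_eq_1)
qed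

lemma ser_T_nonzero: "fps_nth (ser_T (m + 1)) 0 \<noteq> 0"
  using ser_T_nth_0[of m] by simp

lemma ser_U_diff_nonzero: "fps_nth (ser_U i - fps_X * ser_U j) 0 \<noteq> 0"
  unfolding ser_U_diff_nth_0 by simp

theorem theorem2:
  fixes k :: nat
  assumes "k \<ge> 1"
  shows "(\<forall>n. num_balanced k n = num_ud_paths k n) \<and>
    (\<forall>m. k = 2 * m \<longrightarrow>
      Abs_fps (\<lambda>n. real (num_balanced k n)) =
        (ser_U m / ser_T (m + 1)) *
        ((ser_U m + fps_X * ser_U (m - 1)) / (ser_U m - fps_X * ser_U (m - 1)))) \<and>
    (\<forall>m. k = 2 * m + 1 \<longrightarrow>
      Abs_fps (\<lambda>n. real (num_balanced k n)) =
        ((ser_U (m + 1) + fps_X * ser_U m) / (ser_U (m + 1) - fps_X * ser_U m)) *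
        (ser_U m / ser_T (m + 1)))"
  unfolding balanced_ser_def[symmetric]
proof (intro conjI allI impI)
  show "num_balanced k n = num_ud_paths k n" for n
    by (rule num_balanced_eq_num_ud_paths)
next
  fix m assume k: "k = 2 * m"
  \<comment> \<open>From \<open>k \<ge> 1\<close> follows \<open>m > 0\<close>, so
    \<open>m - 1\<close> is a true predecessor and \<open>cheb_ser m\<close> is
    \<open>ser_U (m - 1)\<close>.\<close>
  then obtain j where "m = Suc j"
    using assms by (cases m) auto
  then have "ser_T (m + 1) * (ser_U m - fps_X * ser_U (m - 1)) * balanced_ser k =
      ser_U m * (ser_U m + fps_X * ser_U (m - 1))"
    using balanced_ser_even[of m] k by (simp add: cheb_ser_Suc)
  then show "balanced_ser k = (ser_U m / ser_T (m + 1)) *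
      ((ser_U m + fps_X * ser_U (m - 1)) / (ser_U m - fps_X * ser_U (m - 1)))"
    by (rule fps_eq_mult_divide) (fact ser_T_nonzero ser_U_diff_nonzero)+
next
  fix m assume "k = 2 * m + 1"
  then have "(ser_U (m + 1) - fps_X * ser_U m) * ser_T (m + 1) * balanced_ser k =
      (ser_U (m + 1) + fps_X * ser_U m) * ser_U m"
    using balanced_ser_odd[of m] by (simp add: cheb_ser_Suc mult.commute)
  then show "balanced_ser k =
      ((ser_U (m + 1) + fps_X * ser_U m) / (ser_U (m + 1) - fps_X * ser_U m)) *
      (ser_U m / ser_T (m + 1))"
    by (rule fps_eq_mult_divide) (fact ser_T_nonzero ser_U_diff_nonzero)+
qed

end
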